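(* Let $m > 6$ be an integer and $p$ a prime with $p \equiv 1 \pmod{2m}$. Let $g$ be a primitive root modulo $p$, $k = (p-1)/m$, and for $i \in \{0,\ldots,m-1\}$ let $X_i = \{g^{am+i} \bmod p : 0 \le a < k\}$. Suppose the $m$-color multiplicative-coset Ramsey algebra is constructible over $\mathbb{Z}/p\mathbb{Z}$, i.e., (i) $-X_i = X_i$ for all $i$; (ii) $X_i + X_i = (\mathbb{Z}/p\mathbb{Z}) \setminus X_i$ for all $i$; (iii) $X_i + X_j = (\mathbb{Z}/p\mathbb{Z}) \setminus \{0\}$ for all $i \neq j$. Then \[ 2m^2 - 2m + 1 \le p \le m^4 + 5. \]
   Context: For $A, B \subseteq \mathbb{Z}/p\mathbb{Z}$, $A + B = \{a+b : a\in A, b \in B\}$ and $-A = \{-a : a \in A\}$. The sets $X_i$ are the $m$ cosets of the subgroup of $(\mathbb{Z}/p\mathbb{Z})^\times$ of index $m$ (with $X_0$ the subgroup itself). *)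

theory Defs
  imports "HOL-Number_Theory.Number_Theory" "HOL-Algebra.AbelCoset"
begin

text \<open>
  \<open>\<int>/p\<int>\<close> is the ring \<^term>\<open>residue_ring p\<close> on the canonical representatives \<open>{0..p - 1}\<close>.
  The division \<open>(p - 1) div m\<close> is exact wherever \<open>p \<equiv> 1\<close> modulo \<open>m\<close>.
\<close>

definition color_coset :: "nat \<Rightarrow> nat \<Rightarrow> nat \<Rightarrow> nat \<Rightarrow> int set" where
  "color_coset p m g i = {int (g ^ (a * m + i) mod p) | a. a < (p - 1) div m}"

definition ramsey_constructible :: "nat \<Rightarrow> nat \<Rightarrow> nat \<Rightarrow> bool" where
  "ramsey_constructible p m g \<longleftrightarrow>
     (let R = residue_ring (int p); X = color_coset p m g in
       (\<forall>i<m. a_set_inv\<^bsub>R\<^esub> (X i) = X i) \<and>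
       (\<forall>i<m. X i <+>\<^bsub>R\<^esub> X i = carrier R - X i) \<and>
       (\<forall>i<m. \<forall>j<m. i \<noteq> j \<longrightarrow> X i <+>\<^bsub>R\<^esub> X j = carrier R - {\<zero>\<^bsub>R\<^esub>}))"

end

theory Submission
  imports Defs "HOL-Library.Real_Mod"
begin

text \<open>
  Write \<open>k = (p - 1) / m\<close> for the order of the subgroup \<open>X\<^sub>0\<close>.

  Lower bound: \<open>X\<^sub>0 + X\<^sub>0\<close> contains the \<open>(m - 1) k\<close> nonzero elements outside \<open>X\<^sub>0\<close>, whereas \<open>k\<^sup>2 / 2\<close>
  unordered pairs (repetitions allowed) from \<open>X\<^sub>0 = -X\<^sub>0\<close> have nonzero sum; hence \<open>k \<ge> 2 (m - 1)\<close>.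

  Upper bound: let \<open>f\<close> be the Fourier transform of the indicator function of \<open>X\<^sub>0\<close>. By Parseval,
  \<open>\<Sum>\<bar>f t\<bar>\<^sup>2 = p k\<close>, and since \<open>f\<close> is constant on the orbits of \<open>X\<^sub>0\<close>, every \<open>t \<noteq> 0\<close> satisfies
  \<open>\<bar>f t\<bar>\<^sup>2 \<le> p - k\<close>. As \<open>X\<^sub>0\<close> is sum-free, \<open>\<Sum> (f t)\<^sup>2 cnj (f t) = 0\<close>, where the term \<open>t = 0\<close> is \<open>k\<^sup>3\<close>.
  Hence \<open>k\<^sup>3 \<le> sqrt (p - k) (p k - k\<^sup>2)\<close>, that is, \<open>k\<^sup>4 \<le> (p - k)\<^sup>3 = ((m - 1) k + 1)\<^sup>3\<close>, which forces
  \<open>k \<le> (m - 1)\<^sup>3\<close>.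
\<close>

section \<open>Additive characters modulo \<open>p\<close>\<close>

definition add_char :: "int \<Rightarrow> int \<Rightarrow> complex" where
  "add_char p n = cis (2 * pi * (of_int n / of_int p))"

lemma add_char_add: "add_char p (a + b) = add_char p a * add_char p b"
  by (simp add: add_char_def cis_mult add_divide_distrib distrib_left)

lemma add_char_diff: "add_char p (a - b) = add_char p a * cnj (add_char p b)"
  using add_char_add[of p a "- b"] by (simp add: add_char_def cis_cnj)

lemma add_char_0 [simp]: "add_char p 0 = 1"
  by (simp add: add_char_def)

lemma add_char_eq_1_iff:
  assumes "p > 0"
  shows "add_char p n = 1 \<longleftrightarrow> p dvd n"
proof -
  have "add_char p n = 1 \<longleftrightarrow> (\<exists>j::int. 2 * pi * (of_int n / of_int p) = of_int j * (2 * pi))"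
    by (simp add: add_char_def cis_eq_1_iff)
  also have "\<dots> \<longleftrightarrow> (\<exists>j::int. real_of_int n = of_int (p * j))"
    using assms by (intro iff_exI) (auto simp: field_simps)
  also have "\<dots> \<longleftrightarrow> p dvd n"
    by (simp only: of_int_eq_iff dvd_def)
  finally show ?thesis .
qed

lemma add_char_cong:
  assumes "p > 0" "[a = b] (mod p)"
  shows "add_char p a = add_char p b"
proof -
  have "add_char p (a - b) = 1"
    using assms by (simp add: add_char_eq_1_iff cong_iff_dvd_diff)
  then show ?thesis
    using add_char_add[of p "a - b" b] by simp
qed

text \<open>Orthogonality of characters: the sum is geometric with ratio
  \<open>add_char p n\<close>, a \<open>p\<close>-th root of unity that equals 1 only when
  \<open>p\<close> divides \<open>n\<close>.\<close>

lemma sum_add_char: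
  assumes "p > 0"
  shows "(\<Sum>t\<in>{0..<p}. add_char p (n * t)) = (if p dvd n then of_int p else 0)"
proof (cases "p dvd n")
  case True
  then have "add_char p (n * t) = 1" for t
    using assms by (simp add: add_char_eq_1_iff)
  with True assms show ?thesis by simp
next
  case False
  then have ne: "add_char p n \<noteq> 1"
    using assms by (simp add: add_char_eq_1_iff)
  have pow: "add_char p n ^ j = add_char p (n * int j)" for j
    by (simp add: add_char_def DeMoivre field_simps)
  have "(\<Sum>t\<in>{0..<p}. add_char p (n * t)) = (\<Sum>j<nat p. add_char p n ^ j)"
    by (rule sum.reindex_bij_witness[of _ int nat]) (auto simp: pow)
  also have "\<dots> = (add_char p n ^ nat p - 1) / (add_char p n - 1)"
    using ne by (simp add: geometric_sum)
  also have "add_char p n ^ nat p = 1"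
    using assms by (simp add: pow add_char_eq_1_iff)
  finally show ?thesis using False by simp
qed

lemma mult_mod_inj_on:
  fixes p t :: int
  assumes "coprime t p" "X \<subseteq> {0..<p}"
  shows "inj_on (\<lambda>x. x * t mod p) X"
proof (rule inj_onI)
  fix x y assume "x \<in> X" "y \<in> X" "x * t mod p = y * t mod p"
  then have "[x = y] (mod p)"
    using assms(1) by (simp add: cong_def[symmetric] cong_mult_rcancel)
  moreover have "0 \<le> x \<and> x < p \<and> 0 \<le> y \<and> y < p"
    using \<open>x \<in> X\<close> \<open>y \<in> X\<close> assms(2) by auto
  ultimately show "x = y"
    by (simp add: cong_def)
qed

section \<open>Fourier transform of a multiplicatively closed, sum-free set\<close>

locale mult_closed_sum_free =
  fixes p :: int and X :: "int set"
  assumes prime: "prime p"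
    and subset: "X \<subseteq> {1..<p}"
    and mult_closed: "\<And>x y. x \<in> X \<Longrightarrow> y \<in> X \<Longrightarrow> x * y mod p \<in> X"
    and sum_free: "\<And>x y. x \<in> X \<Longrightarrow> y \<in> X \<Longrightarrow> (x + y) mod p \<notin> X"
begin

definition f :: "int \<Rightarrow> complex" where
  "f t = (\<Sum>x\<in>X. add_char p (x * t))"

lemma p_pos: "p > 0"
  using prime by (simp add: prime_gt_0_int)

lemma finite_X: "finite X"
  using subset finite_subset by blast

lemma card_le: "int (card X) \<le> p - 1"
  using card_mono[OF _ subset] p_pos by auto

lemma coprime_p: "t \<in> {1..<p} \<Longrightarrow> coprime t p"
  using prime by (metis atLeastLessThan_iff coprime_commute not_less prime_imp_coprime
      zdvd_imp_le zless_add1_eq add_0 int_one_le_iff_zero_less)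

lemma f_0: "f 0 = of_nat (card X)"
  by (simp add: f_def)

text \<open>Multiplication by \<open>x\<close> is injective, as \<open>x\<close> is a unit, and maps
  the finite set \<open>X\<close> into itself. It therefore permutes \<open>X\<close>, and the sum
  can be reindexed; no inverses in \<open>X\<close> have to be assumed.\<close>

lemma f_orbit:
  assumes "x \<in> X"
  shows "f (x * t mod p) = f t"
proof -
  have inj: "inj_on (\<lambda>y. y * x mod p) X"
    using assms subset coprime_p by (intro mult_mod_inj_on) auto
  have img: "(\<lambda>y. y * x mod p) ` X = X"
    using assms mult_closed by (intro endo_inj_surj finite_X inj) auto
  have "f (x * t mod p) = (\<Sum>y\<in>X. add_char p ((y * x mod p) * t))"
    unfolding f_def by (intro sum.cong refl add_char_cong p_pos)
      (simp add: cong_def mod_simps mult.assoc)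
  also have "\<dots> = (\<Sum>y\<in>(\<lambda>y. y * x mod p) ` X. add_char p (y * t))"
    by (simp add: sum.reindex[OF inj])
  also have "\<dots> = f t"
    by (simp only: img f_def)
  finally show ?thesis .
qed

text \<open>Expanding the square and summing over \<open>t\<close> first, orthogonality leaves only
  the diagonal \<open>x = y\<close>, each of whose \<open>card X\<close> terms contributes
  \<open>p\<close>.\<close>

lemma parseval: "(\<Sum>t\<in>{0..<p}. (norm (f t))\<^sup>2) = of_int p * card X"
proof -
  have "complex_of_real (\<Sum>t\<in>{0..<p}. (norm (f t))\<^sup>2) = (\<Sum>t\<in>{0..<p}. f t * cnj (f t))"
    by (simp add: complex_norm_square del: of_real_power)
  also have "\<dots> = (\<Sum>t\<in>{0..<p}. \<Sum>x\<in>X. \<Sum>y\<in>X. add_char p ((x - y) * t))"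
    by (simp add: f_def sum_product left_diff_distrib add_char_diff)
  also have "\<dots> = (\<Sum>x\<in>X. \<Sum>y\<in>X. \<Sum>t\<in>{0..<p}. add_char p ((x - y) * t))"
    by (simp only: sum.swap[of _ X "{0..<p}"])
  also have "\<dots> = (\<Sum>x\<in>X. \<Sum>y\<in>X. if x = y then of_int p else 0)"
  proof (intro sum.cong refl)
    fix x y assume "x \<in> X" "y \<in> X"
    then have "0 \<le> x \<and> x < p \<and> 0 \<le> y \<and> y < p"
      using subset by auto
    then have "p dvd x - y \<longleftrightarrow> x = y"
      by (simp flip: mod_eq_dvd_iff)
    then show "(\<Sum>t\<in>{0..<p}. add_char p ((x - y) * t)) = (if x = y then of_int p else 0)"
      by (simp add: sum_add_char[OF p_pos])
  qed
  also have "\<dots> = complex_of_real (of_int p * card X)"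
    using finite_X by simp
  finally show ?thesis
    by (simp only: of_real_eq_iff)
qed

text \<open>By orthogonality the left side is \<open>p\<close> times the number of solutions of
  \<open>x + y = z\<close> modulo \<open>p\<close> in \<open>X\<close>, and there are none.\<close>

lemma cubic_moment: "(\<Sum>t\<in>{0..<p}. (f t)\<^sup>2 * cnj (f t)) = 0"
proof -
  have "(\<Sum>t\<in>{0..<p}. (f t)\<^sup>2 * cnj (f t))
      = (\<Sum>t\<in>{0..<p}. \<Sum>z\<in>X. \<Sum>y\<in>X. \<Sum>x\<in>X. add_char p ((x + y - z) * t))"
    by (simp add: f_def power2_eq_square sum_product sum_distrib_left sum_distrib_right
        distrib_right left_diff_distrib add_char_add add_char_diff)
  also have "\<dots> = (\<Sum>z\<in>X. \<Sum>y\<in>X. \<Sum>x\<in>X. \<Sum>t\<in>{0..<p}. add_char p ((x + y - z) * t))"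
    by (simp only: sum.swap[of _ X "{0..<p}"])
  also have "\<dots> = 0"
  proof -
    have "\<not> p dvd x + y - z" if xyz: "x \<in> X" "y \<in> X" "z \<in> X" for x y z
    proof
      assume "p dvd x + y - z"
      then have "(x + y) mod p = z mod p"
        by (simp add: mod_eq_dvd_iff)
      also have "z mod p = z"
        using xyz subset by auto
      finally show False using sum_free xyz by metis
    qed
    then show ?thesis
      by (simp add: sum_add_char[OF p_pos])
  qed
  finally show ?thesis .
qed

text \<open>In the Parseval sum, the point 0 contributes \<open>k\<^sup>2\<close> and the
  \<open>k\<close> points of the orbit of \<open>t\<close> contribute
  \<open>(norm (f t))\<^sup>2\<close> each. The total is \<open>p * k\<close>; dividing by
  \<open>k\<close> needs \<open>X\<close> nonempty.\<close>

lemma norm_f_le: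
  assumes "X \<noteq> {}" "t \<in> {1..<p}"
  shows "(norm (f t))\<^sup>2 \<le> p - card X"
proof -
  define k where "k = real (card X)"
  have k: "k > 0" using assms(1) finite_X by (simp add: k_def card_gt_0_iff)
  have inj: "inj_on (\<lambda>x. x * t mod p) X"
    using assms subset coprime_p by (intro mult_mod_inj_on) auto
  define orb where "orb = (\<lambda>x. x * t mod p) ` X"
  \<comment> \<open>The orbit avoids 0, so the contribution of 0 is not counted twice.\<close>
  have orb: "orb \<subseteq> {1..<p}"
  proof
    fix s assume "s \<in> orb"
    then obtain x where x: "x \<in> X" "s = x * t mod p" by (auto simp: orb_def)
    have "coprime (x * t) p"
      using x assms subset coprime_p by auto
    then have "s \<noteq> 0"
      using prime x by (metis coprime_absorb_right dvd_eq_mod_eq_0 not_prime_unit)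
    with x p_pos show "s \<in> {1..<p}"
      by (smt (verit) atLeastLessThan_iff pos_mod_bound pos_mod_sign)
  qed
  have "k\<^sup>2 + k * (norm (f t))\<^sup>2 = (norm (f 0))\<^sup>2 + (\<Sum>x\<in>X. (norm (f (x * t mod p)))\<^sup>2)"
    by (simp add: f_0 f_orbit k_def)
  also have "\<dots> = (norm (f 0))\<^sup>2 + (\<Sum>s\<in>orb. (norm (f s))\<^sup>2)"
    by (simp add: orb_def sum.reindex[OF inj])
  also have "\<dots> = (\<Sum>s\<in>insert 0 orb. (norm (f s))\<^sup>2)"
    using orb finite_subset[OF orb] by (subst sum.insert) auto
  also have "\<dots> \<le> (\<Sum>s\<in>{0..<p}. (norm (f s))\<^sup>2)"
    using orb p_pos by (intro sum_mono2) auto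
  also have "\<dots> = k * p"
    by (simp add: parseval k_def)
  finally have "k * (k + (norm (f t))\<^sup>2) \<le> k * p"
    by (simp add: power2_eq_square distrib_left)
  then show ?thesis
    using k by (simp add: k_def)
qed

lemma card_bound: "int (card X) ^ 4 \<le> (p - int (card X)) ^ 3"
proof (cases "X = {}")
  case True
  then show ?thesis using p_pos by simp
next
  case False
  define k where "k = real (card X)"
  define d where "d = p - k"
  have k: "k > 0" using False finite_X by (simp add: k_def card_gt_0_iff)
  have d: "d \<ge> 0" using card_le by (simp add: d_def k_def)
  have split: "{0..<p} = insert 0 {1..<p}"
    using p_pos by auto
  have "complex_of_real (k ^ 3) = - (\<Sum>t\<in>{1..<p}. (f t)\<^sup>2 * cnj (f t))"
    using cubic_moment unfolding split
    by (simp add: f_0 k_def power3_eq_cube power2_eq_square add_eq_0_iff)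
  then have "norm (complex_of_real (k ^ 3)) = norm (\<Sum>t\<in>{1..<p}. (f t)\<^sup>2 * cnj (f t))"
    by simp
  then have "k ^ 3 = norm (\<Sum>t\<in>{1..<p}. (f t)\<^sup>2 * cnj (f t))"
    using k by (simp add: norm_power del: of_real_power)
  also have "\<dots> \<le> (\<Sum>t\<in>{1..<p}. (norm (f t))\<^sup>2 * sqrt d)"
  proof (rule sum_norm_le)
    fix t assume "t \<in> {1..<p}"
    then have "norm (f t) \<le> sqrt d"
      using norm_f_le[OF False] by (intro real_le_rsqrt) (simp add: d_def k_def)
    then show "norm ((f t)\<^sup>2 * cnj (f t)) \<le> (norm (f t))\<^sup>2 * sqrt d"
      by (simp add: norm_mult norm_power mult_left_mono)
  qed
  also have "\<dots> = (\<Sum>t\<in>{1..<p}. (norm (f t))\<^sup>2) * sqrt d"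
    by (simp add: sum_distrib_right)
  \<comment> \<open>Parseval without its term at 0:
    \<open>p * k - k\<^sup>2 = k * d\<close>.\<close>
  also have "(\<Sum>t\<in>{1..<p}. (norm (f t))\<^sup>2) = k * d"
    using parseval unfolding split
    by (simp add: f_0 k_def d_def power2_eq_square algebra_simps)
  finally have "k * k\<^sup>2 \<le> k * (d * sqrt d)"
    by (simp add: power3_eq_cube power2_eq_square mult.assoc)
  then have "k\<^sup>2 \<le> d * sqrt d"
    using k by simp
  \<comment> \<open>Squaring removes the root, so that the bound can be stated over the
    integers.\<close>
  then have "(k\<^sup>2)\<^sup>2 \<le> (d * sqrt d)\<^sup>2"
    by (intro power_mono) auto
  also have "(d * sqrt d)\<^sup>2 = d ^ 3"
    using d by (simp add: power_mult_distrib power3_eq_cube power2_eq_square)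
  finally have "real_of_int (int (card X) ^ 4) \<le> real_of_int ((p - int (card X)) ^ 3)"
    by (simp add: k_def d_def flip: power_mult)
  then show ?thesis
    by (simp only: of_int_le_iff)
qed

end

section \<open>Counting sums of a symmetric set, and an elementary inequality\<close>

lemma card_nonzero_sums_le:
  fixes p :: int and X :: "int set"
  assumes "X \<subseteq> {1..<p}" and neg: "\<And>x. x \<in> X \<Longrightarrow> p - x \<in> X"
    and cover: "S \<subseteq> {(x + y) mod p | x y. x \<in> X \<and> y \<in> X}" "0 \<notin> S"
  shows "2 * card S \<le> (card X)\<^sup>2"
proof -
  have fin: "finite X" using assms(1) finite_subset by blast
  \<comment> \<open>The removed pairs are those with sum 0 modulo \<open>p\<close>; there is one for
    each \<open>x\<close>, since \<open>p - x\<close> represents the negative of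
    \<open>x\<close>.\<close>
  define P where "P = X \<times> X - (\<lambda>x. (x, p - x)) ` X"
  \<comment> \<open>\<open>L\<close> and \<open>G\<close> are mirror images that cover
    \<open>P\<close> and meet in at most \<open>card X\<close> diagonal pairs. Adding these back at
    most cancels the \<open>card X\<close> pairs removed above, so \<open>2 * card L\<close> is at
    most \<open>(card X)\<^sup>2\<close>.\<close>
  define L where "L = {(x, y) \<in> P. x \<le> y}"
  define G where "G = {(x, y) \<in> P. y \<le> x}"
  have finP: "finite P" "finite L" "finite G"
    using fin by (auto simp: P_def L_def G_def intro: finite_subset[of _ "X \<times> X"])
  have cardP: "card P + card X = (card X)\<^sup>2"
  proof -
    have "card ((\<lambda>x. (x, p - x)) ` X) = card X"
      by (intro card_image inj_onI) auto
    moreover have "(\<lambda>x. (x, p - x)) ` X \<subseteq> X \<times> X"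
      using neg by auto
    ultimately have "card P = card (X \<times> X) - card X" and "card X \<le> card (X \<times> X)"
      using fin card_mono[of "X \<times> X" "(\<lambda>x. (x, p - x)) ` X"] unfolding P_def
      by (simp_all add: card_Diff_subset)
    then show ?thesis
      by (simp add: card_cartesian_product power2_eq_square)
  qed
  have "card L = card G"
    by (rule bij_betw_same_card[of prod.swap], rule bij_betw_byWitness[of _ prod.swap])
      (auto simp: L_def G_def P_def image_iff)
  moreover have "L \<union> G = P"
    by (auto simp: L_def G_def)
  then have "card P + card (L \<inter> G) = card L + card G"
    using card_Un_Int[OF finP(2,3)] by simp
  moreover have "card (L \<inter> G) \<le> card X"
  proof -
    have "L \<inter> G \<subseteq> (\<lambda>x. (x, x)) ` X"
      by (auto simp: L_def G_def P_def)
    then show ?thesis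
      using fin by (meson card_image_le card_mono finite_imageI le_trans)
  qed
  ultimately have "2 * card L \<le> (card X)\<^sup>2"
    using cardP by linarith
  moreover have "S \<subseteq> (\<lambda>(x, y). (x + y) mod p) ` L"
  proof
    fix s assume s: "s \<in> S"
    then obtain x y where xy: "x \<in> X" "y \<in> X" "s = (x + y) mod p"
      using cover(1) by blast
    have "(x, y) \<in> P" "(y, x) \<in> P"
      using xy s cover(2) by (auto simp: P_def)
    then have "(x, y) \<in> L \<or> (y, x) \<in> L"
      by (auto simp: L_def)
    then show "s \<in> (\<lambda>(x, y). (x + y) mod p) ` L"
      using xy(3) by (force simp: add.commute)
  qed
  then have "card S \<le> card L"
    using finP by (meson card_image_le card_mono finite_imageI le_trans)
  ultimately show ?thesis by linarith
qed

text \<open>If \<open>k > n ^ 3\<close>, then \<open>n \<ge> 3\<close> makes each of the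
  coefficients \<open>n ^ 3\<close>, \<open>3 * n\<^sup>2\<close>, \<open>3 * n\<close> of the
  expanded cube at most \<open>k - 1\<close>. As
  \<open>(k - 1) * (k ^ 3 + k\<^sup>2 + k) = k ^ 4 - k\<close>, this forces
  \<open>k \<le> 1\<close>.\<close>

lemma le_cube_of_quartic_le:
  fixes k n :: int
  assumes "n \<ge> 3" "k ^ 4 \<le> (n * k + 1) ^ 3"
  shows "k \<le> n ^ 3"
proof (rule ccontr)
  assume "\<not> k \<le> n ^ 3"
  then have kn: "n ^ 3 \<le> k - 1" by simp
  have "3 * n\<^sup>2 \<le> n * n\<^sup>2"
    using assms(1) by (intro mult_right_mono) auto
  with kn have k3: "3 * n\<^sup>2 + 1 \<le> k"
    by (simp add: power3_eq_cube power2_eq_square)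
  have "3 * n \<le> n * n" using assms(1) by (intro mult_right_mono) auto
  with k3 assms(1) have kn': "3 * n + 1 \<le> k" "k > 0"
    unfolding power2_eq_square by linarith+
  have "k ^ 4 \<le> n ^ 3 * k ^ 3 + 3 * n\<^sup>2 * k\<^sup>2 + 3 * n * k + 1"
    using assms(2) by (simp add: power3_eq_cube power2_eq_square algebra_simps)
  also have "n ^ 3 * k ^ 3 \<le> (k - 1) * k ^ 3"
    using kn kn' by (intro mult_right_mono) auto
  also have "3 * n\<^sup>2 * k\<^sup>2 \<le> (k - 1) * k\<^sup>2"
    using k3 by (intro mult_right_mono) auto
  also have "3 * n * k \<le> (k - 1) * k"
    using kn' by (intro mult_right_mono) auto
  finally have "k \<le> 1"
    by (simp add: algebra_simps power2_eq_square power3_eq_cube power4_eq_xxxx)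
  with kn' assms(1) show False by linarith
qed

section \<open>The subgroup \<open>X\<^sub>0\<close> and the two bounds\<close>

lemma color_coset_0:
  "color_coset p m g 0 = (\<lambda>a. int (g ^ (a * m) mod p)) ` {..<(p - 1) div m}"
  by (auto simp: color_coset_def)

theorem theorem4:
  fixes m p g :: nat
  assumes "m > 6"
    and "prime p"
    and "[p = 1] (mod (2 * m))"
    and "residue_primroot p g"
    and "ramsey_constructible p m g"
  shows "2 * int m ^ 2 - 2 * int m + 1 \<le> int p \<and> int p \<le> int m ^ 4 + 5"
proof -
  define k where "k = (p - 1) div m"
  define X where "X = color_coset p m g 0"
  define R where "R = residue_ring (int p)"
  have p1: "p > 1" using assms(2) prime_gt_1_nat by blast
  interpret residues "int p" R
    using p1 by unfold_locales (auto simp: R_def)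
  have "2 * m dvd p - 1"
    using assms(3) p1 by (metis cong_altdef_nat less_imp_le)
  then have "m dvd p - 1"
    by (metis dvd_mult_right)
  then have mk: "m * k = p - 1" by (simp add: k_def)
  with p1 have kpos: "k > 0" by (cases k) auto
  have tot: "totient p = p - 1" using assms(2) by (rule totient_prime)
  have gen: "bij_betw (\<lambda>i. g ^ i mod p) {..<p - 1} {0<..<p}"
    using residue_primroot_is_generator[OF p1 assms(4)] totatives_prime[OF assms(2)] tot by simp
  have Ximg: "X = (\<lambda>a. int (g ^ (a * m) mod p)) ` {..<k}"
    by (simp add: X_def color_coset_0 k_def)
  have exponent_less: "a * m < p - 1" if "a < k" for a
    using mult_less_mono1[OF that, of m] assms(1) by (simp only: mult.commute[of k] mk)
  have cardX: "card X = k"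
  proof -
    have "inj_on (\<lambda>a. int (g ^ (a * m) mod p)) {..<k}"
    proof (rule inj_onI)
      fix a b assume "a \<in> {..<k}" "b \<in> {..<k}" "int (g ^ (a * m) mod p) = int (g ^ (b * m) mod p)"
      then have "a * m = b * m"
        using exponent_less inj_onD[OF bij_betw_imp_inj_on[OF gen], of "a * m" "b * m"] by simp
      then show "a = b" using assms(1) by simp
    qed
    then show ?thesis by (simp add: Ximg card_image)
  qed
  have Xsub: "X \<subseteq> {1..<int p}"
  proof
    fix x assume "x \<in> X"
    then obtain a where a: "a < k" "x = int (g ^ (a * m) mod p)" by (auto simp: Ximg)
    then have "g ^ (a * m) mod p \<in> {0<..<p}"
      using bij_betw_apply[OF gen, of "a * m"] exponent_less p1 by simp
    with a p1 show "x \<in> {1..<int p}" by simp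
  qed
  have g_power: "g ^ (p - 1) mod p = 1"
    using assms(4) p1 ord_works[of g p] tot
    by (metis cong_def mod_less residue_primroot_def)
  have Xmult: "x * y mod int p \<in> X" if "x \<in> X" "y \<in> X" for x y
  proof -
    obtain a b where ab: "x = int (g ^ (a * m) mod p)" "y = int (g ^ (b * m) mod p)"
      using \<open>x \<in> X\<close> \<open>y \<in> X\<close> by (auto simp: Ximg)
    \<comment> \<open>The exponent \<open>a + b\<close> may leave the range below \<open>k\<close>.
      Reducing it modulo \<open>k\<close> changes \<open>(a + b) * m\<close> by a multiple of
      \<open>m * k = p - 1\<close>, which does not affect the power of \<open>g\<close>.\<close>
    have "(a + b) * m = (k * ((a + b) div k) + (a + b) mod k) * m"
      by simp
    also have "\<dots> = (p - 1) * ((a + b) div k) + (a + b) mod k * m"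
      by (simp only: mk[symmetric] add_mult_distrib distrib_left mult_ac)
    finally have "(a + b) * m = (p - 1) * ((a + b) div k) + (a + b) mod k * m" .
    then have "g ^ ((a + b) * m) mod p = (g ^ (p - 1)) ^ ((a + b) div k) * g ^ ((a + b) mod k * m) mod p"
      by (simp add: power_add power_mult)
    also have "\<dots> = (g ^ (p - 1) mod p) ^ ((a + b) div k) * g ^ ((a + b) mod k * m) mod p"
      by (rule mod_mult_cong) (simp_all only: power_mod)
    also have "\<dots> = g ^ ((a + b) mod k * m) mod p"
      by (simp only: g_power power_one mult_1)
    finally have "g ^ (a * m) * g ^ (b * m) mod p = g ^ ((a + b) mod k * m) mod p"
      by (simp only: add_mult_distrib power_add)
    moreover have "x * y mod int p = int ((g ^ (a * m) mod p) * (g ^ (b * m) mod p) mod p)"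
      by (simp only: ab of_nat_mult of_nat_mod)
    ultimately have "x * y mod int p = int (g ^ ((a + b) mod k * m) mod p)"
      by (simp only: mod_mult_eq)
    then show ?thesis
      using kpos by (auto simp: Ximg)
  qed
  have neg: "a_set_inv\<^bsub>R\<^esub> X = X" and sums: "X <+>\<^bsub>R\<^esub> X = carrier R - X"
    using assms(1,5) by (auto simp: ramsey_constructible_def Let_def X_def R_def)
  have Xneg: "int p - x \<in> X" if "x \<in> X" for x
  proof -
    have "(- x) mod int p \<in> X"
      using that neg by (auto simp: A_SET_INV_def' res_neg_eq)
    moreover have "0 < x \<and> x < int p"
      using that Xsub by auto
    then have "(- x) mod int p = int p - x"
      by (simp add: zmod_zminus1_eq_if)
    ultimately show ?thesis by simp
  qed
  have sums': "{(x + y) mod int p | x y. x \<in> X \<and> y \<in> X} = {0..<int p} - X"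
  proof -
    have "X <+>\<^bsub>R\<^esub> X = {(x + y) mod int p | x y. x \<in> X \<and> y \<in> X}"
      by (auto simp: set_add_def' res_add_eq)
    moreover have "carrier R = {0..<int p}"
      by (auto simp: res_carrier_eq)
    ultimately show ?thesis
      using sums by simp
  qed
  have Xfree: "(x + y) mod int p \<notin> X" if "x \<in> X" "y \<in> X" for x y
    using that sums' by blast
  interpret mult_closed_sum_free "int p" X
    using assms(2) Xsub Xmult Xfree by unfold_locales simp_all
  have "p = m * k + 1"
    using mk p1 by simp
  then have pmk: "int p = int m * int k + 1"
    by simp
  \<comment> \<open>The nonzero residues outside \<open>X\<close> are all sums; there are
    \<open>p - 1 - k = (m - 1) * k\<close> of them.\<close>
  have "{1..<int p} - X \<subseteq> {(x + y) mod int p | x y. x \<in> X \<and> y \<in> X}"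
    unfolding sums' by auto
  then have "2 * card ({1..<int p} - X) \<le> k\<^sup>2"
    using card_nonzero_sums_le[OF Xsub Xneg] cardX by simp
  moreover have "card ({1..<int p} - X) = p - 1 - k"
    using Xsub finite_X cardX by (subst card_Diff_subset) auto
  ultimately have "2 * (p - 1 - k) \<le> k * k"
    by (simp add: power2_eq_square)
  also have "p - 1 - k = (m - 1) * k"
    by (simp only: mk[symmetric] diff_mult_distrib mult_1)
  finally have "2 * (m - 1) \<le> k"
    using kpos by (metis mult.assoc mult_le_cancel2)
  then have "int m * (2 * (int m - 1)) \<le> int m * int k"
    using assms(1) by (intro mult_left_mono) auto
  then have lower: "2 * int m ^ 2 - 2 * int m + 1 \<le> int p"
    by (simp add: pmk power2_eq_square algebra_simps)
  \<comment> \<open>Here \<open>p - k = (m - 1) * k + 1\<close>, the shape required with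
    \<open>n = m - 1\<close>.\<close>
  have "int k ^ 4 \<le> ((int m - 1) * int k + 1) ^ 3"
    using card_bound by (simp add: cardX pmk algebra_simps)
  then have "int k \<le> (int m - 1) ^ 3"
    using assms(1) le_cube_of_quartic_le[of "int m - 1" "int k"] by simp
  also have "\<dots> \<le> int m ^ 3"
    using assms(1) by (intro power_mono) auto
  \<comment> \<open>Adding 1 turns this into \<open>p \<le> m ^ 4 + 1\<close>.\<close>
  finally have "int m * int k \<le> int m * int m ^ 3"
    by (intro mult_left_mono) auto
  then have "int p \<le> int m ^ 4 + 5"
    by (simp add: pmk power3_eq_cube power4_eq_xxxx)
  with lower show ?thesis by simp
qed

end
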